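(* Let $\mathcal{K}^{\langle 0\rangle}$ be a simple nested fractal in $\mathbb{R}^2$ with $k$ essential fixed points. If $k>4$ and $k\neq 6$, then $\mathcal{B}_{\mathcal{K}^{\langle 1\rangle}}\notin\mathcal{K}^{\langle 1\rangle}$.
   Context: Simple nested fractal (SNF). Let $\Psi_i:\mathbb{R}^2\to\mathbb{R}^2$, $\Psi_i(x)=x/L+\nu_i$, $i=1,\dots,N$, with $L>1$, $\nu_i\in\mathbb{R}^2$. $\mathcal{K}^{\langle 0\rangle}$ is the unique nonempty compact set with $\mathcal{K}^{\langle 0\rangle}=\bigcup_{i=1}^N\Psi_i(\mathcal{K}^{\langle 0\rangle})$. Let $F$ be the set of fixed points of the $\Psi_i$. A point $x\in F$ is an essential fixed point if there are another fixed point $y\in F$ and two different maps $\Psi_i,\Psi_j$ with $\Psi_i(x)=\Psi_j(y)$. $V_0^{\langle 0\rangle}$ is the set of essential fixed points and $k=\#V_0^{\langle 0\rangle}$. $\mathcal{K}^{\langle 0\rangle}$ is an SNF if: (1) $k\ge 2$; (2) (Open Set Condition) there is an open $U\subset\mathbb{R}^2$ with $\Psi_i(U)\cap\Psi_j(U)=\emptyset$ for $i\ne j$ and $\bigcup_i\Psi_i(U)\subseteq U$; (3) (Nesting) $\Psi_i(\mathcal{K}^{\langle 0\rangle})\cap\Psi_j(\mathcal{K}^{\langle 0\rangle})=\Psi_i(V_0^{\langle 0\rangle})\cap\Psi_j(V_0^{\langle 0\rangle})$ for $i\neq j$; (4) (Symmetry) for $x,y\in V_0^{\langle 0\rangle}$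 let $S_{x,y}$ be the reflection in the line perpendicularly bisecting $[x,y]$; for all $i\in\{1,\dots,N\}$ and all $x,y\in V_0^{\langle 0\rangle}$ there is $j\in\{1,\dots,N\}$ with $S_{x,y}(\Psi_i(V_0^{\langle 0\rangle}))=\Psi_j(V_0^{\langle 0\rangle})$; (5) (Connectivity) the graph on $V_{-1}^{\langle 0\rangle}=\bigcup_i\Psi_i(V_0^{\langle 0\rangle})$ in which $x,y$ are joined iff $x,y\in\Psi_i(\mathcal{K}^{\langle 0\rangle})$ for some $i$ is connected. For $k\ge 3$ it is known that $V_0^{\langle 0\rangle}$ is the vertex set of a regular $k$-gon. $\mathcal{K}^{\langle 1\rangle}=L\,\mathcal{K}^{\langle 0\rangle}$, with vertex set $L V_0^{\langle 0\rangle}$, and $\mathcal{B}_{\mathcal{K}^{\langle 1\rangle}}$ is its barycenter (the center of the regular $k$-gon spanned by $L V_0^{\langle 0\rangle}$). *)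

theory Defs
  imports "HOL-Analysis.Analysis"
begin

text \<open>
  The definitions make sense in any Euclidean space (where the bisector of a segment is a
  hyperplane); they are used for \<open>real^2\<close>.  An iterated function system is given by the scaling
  factor \<open>L\<close>, the number \<open>N\<close> of maps and the translation vectors \<open>\<nu> i\<close>, of which only those with
  index in \<open>{1..N}\<close> matter.
\<close>

definition sim :: "real \<Rightarrow> (nat \<Rightarrow> 'a::euclidean_space) \<Rightarrow> nat \<Rightarrow> 'a \<Rightarrow> 'a" where
  "sim L \<nu> i x = x /\<^sub>R L + \<nu> i"

definition fixed_points :: "real \<Rightarrow> nat \<Rightarrow> (nat \<Rightarrow> 'a::euclidean_space) \<Rightarrow> 'a set" where
  "fixed_points L N \<nu> = {x. \<exists>i\<in>{1..N}. sim L \<nu> i x = x}"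

definition essential_fixed_points :: "real \<Rightarrow> nat \<Rightarrow> (nat \<Rightarrow> 'a::euclidean_space) \<Rightarrow> 'a set" where
  "essential_fixed_points L N \<nu> =
     {x \<in> fixed_points L N \<nu>.
        \<exists>y\<in>fixed_points L N \<nu>. y \<noteq> x \<and>
          (\<exists>i\<in>{1..N}. \<exists>j\<in>{1..N}. sim L \<nu> i \<noteq> sim L \<nu> j \<and> sim L \<nu> i x = sim L \<nu> j y)}"

definition bisector_reflection :: "'a::euclidean_space \<Rightarrow> 'a \<Rightarrow> 'a \<Rightarrow> 'a" where
  "bisector_reflection x y z =
     z - (2 * ((z - midpoint x y) \<bullet> (y - x)) / (norm (y - x))\<^sup>2) *\<^sub>R (y - x)"

definition cell_vertices :: "real \<Rightarrow> nat \<Rightarrow> (nat \<Rightarrow> 'a::euclidean_space) \<Rightarrow> 'a set" where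
  "cell_vertices L N \<nu> = (\<Union>i\<in>{1..N}. sim L \<nu> i ` essential_fixed_points L N \<nu>)"

definition cell_graph ::
    "real \<Rightarrow> nat \<Rightarrow> (nat \<Rightarrow> 'a::euclidean_space) \<Rightarrow> 'a set \<Rightarrow> ('a \<times> 'a) set" where
  "cell_graph L N \<nu> K =
     {(x, y). x \<in> cell_vertices L N \<nu> \<and> y \<in> cell_vertices L N \<nu> \<and>
        (\<exists>i\<in>{1..N}. x \<in> sim L \<nu> i ` K \<and> y \<in> sim L \<nu> i ` K)}"

text \<open>
  The nonempty compact invariant set of the maps is unique, so the first three clauses after
  \<open>L > 1\<close> determine \<open>K\<close>.  The set \<open>U\<close> of the open set condition is nonempty, as usual (for
  \<open>U = {}\<close> the condition would be void).  The symmetry condition quantifies over \<open>x \<noteq> y\<close>, as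
  the segment \<open>[x, x]\<close> has no bisector.
\<close>

definition simple_nested_fractal ::
    "real \<Rightarrow> nat \<Rightarrow> (nat \<Rightarrow> 'a::euclidean_space) \<Rightarrow> 'a set \<Rightarrow> bool" where
  "simple_nested_fractal L N \<nu> K \<longleftrightarrow>
     L > 1 \<and>
     compact K \<and> K \<noteq> {} \<and> K = (\<Union>i\<in>{1..N}. sim L \<nu> i ` K) \<and>
     card (essential_fixed_points L N \<nu>) \<ge> 2 \<and>
     (\<exists>U. open U \<and> U \<noteq> {} \<and>
        (\<forall>i\<in>{1..N}. \<forall>j\<in>{1..N}. i \<noteq> j \<longrightarrow> sim L \<nu> i ` U \<inter> sim L \<nu> j ` U = {}) \<and>
        (\<Union>i\<in>{1..N}. sim L \<nu> i ` U) \<subseteq> U) \<and>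
     (\<forall>i\<in>{1..N}. \<forall>j\<in>{1..N}. i \<noteq> j \<longrightarrow>
        sim L \<nu> i ` K \<inter> sim L \<nu> j ` K =
        sim L \<nu> i ` essential_fixed_points L N \<nu> \<inter> sim L \<nu> j ` essential_fixed_points L N \<nu>) \<and>
     (\<forall>i\<in>{1..N}. \<forall>x\<in>essential_fixed_points L N \<nu>. \<forall>y\<in>essential_fixed_points L N \<nu>. x \<noteq> y \<longrightarrow>
        (\<exists>j\<in>{1..N}. bisector_reflection x y ` sim L \<nu> i ` essential_fixed_points L N \<nu> =
           sim L \<nu> j ` essential_fixed_points L N \<nu>)) \<and>
     (\<forall>x\<in>cell_vertices L N \<nu>. \<forall>y\<in>cell_vertices L N \<nu>. (x, y) \<in> (cell_graph L N \<nu> K)\<^sup>*)"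

text \<open>
  The barycenter of a finite set of points.  For the vertex set of a regular polygon it is the
  center of the polygon, see \<open>barycenter_regular_polygon\<close> below.
\<close>

definition barycenter :: "'a::euclidean_space set \<Rightarrow> 'a" where
  "barycenter V = (\<Sum>v\<in>V. v) /\<^sub>R real (card V)"

lemma bisector_reflection_swaps:
  "bisector_reflection x y x = y" "bisector_reflection x y y = x"
proof -
  have *: "(x - midpoint x y) = (-1/2) *\<^sub>R (y - x)" "(y - midpoint x y) = (1/2) *\<^sub>R (y - x)"
    by (simp_all add: midpoint_def algebra_simps flip: scaleR_add_left)
  show "bisector_reflection x y x = y" "bisector_reflection x y y = x"
    unfolding bisector_reflection_def * inner_scaleR_left
    by (cases "x = y"; simp add: power2_norm_eq_inner)+
qed

lemma bisector_reflection_fixed_iff: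
  assumes "x \<noteq> y"
  shows "bisector_reflection x y z = z \<longleftrightarrow> dist x z = dist y z"
proof -
  have "dist x z = dist y z \<longleftrightarrow> (x - z) \<bullet> (x - z) = (y - z) \<bullet> (y - z)"
    by (simp add: dist_norm norm_eq)
  also have "\<dots> \<longleftrightarrow> (z - midpoint x y) \<bullet> (y - x) = 0"
    by (auto simp: midpoint_def inner_diff_left inner_diff_right inner_add_left
          inner_commute algebra_simps)
  finally show ?thesis
    using assms by (auto simp: bisector_reflection_def)
qed

lemma barycenter_regular_polygon:
  fixes c :: "real^2"
  assumes n: "n \<ge> 3" and r: "r > 0"
    and V: "V = (\<lambda>j. c + r *\<^sub>R vector [cos (t + 2 * pi * real j / real n),
                                      sin (t + 2 * pi * real j / real n)]) ` {..<n}"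
  shows "card V = n" "barycenter V = c"
proof -
  define f :: "nat \<Rightarrow> real^2" where
    "f j = c + r *\<^sub>R vector [cos (t + 2 * pi * real j / real n),
                              sin (t + 2 * pi * real j / real n)]" for j
  define w where "w j = cis (2 * pi * real j / real n)" for j
  have w: "bij_betw w {..<n} {z. z ^ n = 1}"
    unfolding w_def using n by (intro Complex.bij_betw_roots_unity) simp
  have cis_eq: "cis (t + 2 * pi * real j / real n) = cis t * w j" for j
    by (simp add: w_def cis_mult)
  have inj: "inj_on f {..<n}"
  proof (rule inj_onI)
    fix i j assume ij: "i \<in> {..<n}" "j \<in> {..<n}" "f i = f j"
    from ij(3) r have "cis (t + 2 * pi * real i / real n) = cis (t + 2 * pi * real j / real n)"
      by (auto simp: f_def vec_eq_iff forall_2 vector_2 complex_eq_iff)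
    hence "w i = w j"
      by (simp add: cis_eq cis_neq_zero)
    thus "i = j"
      using w ij by (auto simp: bij_betw_def inj_on_def)
  qed
  have Vf: "V = f ` {..<n}"
    by (simp add: V f_def)
  show card: "card V = n"
    using inj by (simp add: Vf card_image)
  have "(\<Sum>j<n. w j) = 0"
    using sum.reindex_bij_betw[OF w, of "\<lambda>z. z"] sum_roots_unity[of n] n by simp
  hence 0: "(\<Sum>j<n. cis (t + 2 * pi * real j / real n)) = 0"
    by (simp add: cis_eq flip: sum_distrib_left)
  have cs: "(\<Sum>j<n. cos (t + 2 * pi * real j / real n)) = 0"
           "(\<Sum>j<n. sin (t + 2 * pi * real j / real n)) = 0"
    using arg_cong[OF 0, of Re] arg_cong[OF 0, of Im] by simp_all
  have "(\<Sum>v\<in>V. v) = (\<Sum>j<n. f j)"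
    using inj by (simp add: Vf sum.reindex)
  also have "\<dots> = real n *\<^sub>R c"
    using cs by (simp add: vec_eq_iff forall_2 f_def vector_2 sum.distrib of_nat_index flip: sum_distrib_left)
  finally show "barycenter V = c"
    using n by (simp add: barycenter_def card)
qed

end

(* Center the essential fixed points V at their barycenter and scale by L, so that cells become
   translates K + a.  If a mirror of V does not map the cell K + a to itself, then by nesting the
   cell can meet the mirror only in its vertices.  A hyperplane meeting K only in vertices leaves V
   on one side: two common vertices p and q are impossible since the small cell at p contains
   p + (q - p) / L, and one common vertex would be a cut point of the connected set K, hence by
   symmetry all vertices would be cut points separating V.  So no mirror cuts through the vertices
   of a cell that it moves.
   If the barycenter 0 lies in K, then there is a cell with vertex 0 or a cell with center 0, which
   has a neighboring cell; thus there is a cell K + a with a = -v or a = v - w for vertices v, w.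
   The vertices form a regular k-gon, and for k = 5 or k > 6 some mirror has an angle with a that is
   small enough for it to cut through K + a. *)

theory Submission
  imports Defs
begin

section \<open>Reflections\<close>

definition refl_along :: "'a::real_inner \<Rightarrow> 'a \<Rightarrow> 'a" where
  "refl_along u z = z - (2 * (z \<bullet> u) / (u \<bullet> u)) *\<^sub>R u"

lemma linear_refl_along: "linear (refl_along u)"
  by (rule linearI)
    (simp_all add: refl_along_def inner_add_left add_divide_distrib algebra_simps)

lemma refl_along_inner_normal: "refl_along u z \<bullet> u = - (z \<bullet> u)"
  by (cases "u = 0") (simp_all add: refl_along_def inner_diff_left)

lemma refl_along_involution [simp]: "refl_along u (refl_along u z) = z"
proof -
  have "refl_along u (refl_along u z) =
      refl_along u z + (2 * (z \<bullet> u) / (u \<bullet> u)) *\<^sub>R u"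
    by (subst refl_along_def) (simp add: refl_along_inner_normal)
  then show ?thesis by (simp add: refl_along_def)
qed

lemma norm_refl_along [simp]: "norm (refl_along u z) = norm z"
proof (cases "u = 0")
  case False
  then have "refl_along u z \<bullet> refl_along u z = z \<bullet> z"
    by (simp add: refl_along_def inner_diff_left inner_diff_right inner_commute field_simps)
  then show ?thesis by (simp add: norm_eq_sqrt_inner)
qed (simp add: refl_along_def)

lemma refl_along_fixed: "z \<bullet> u = 0 \<Longrightarrow> refl_along u z = z"
  by (simp add: refl_along_def)

lemma refl_along_moves:
  assumes "z \<bullet> u \<noteq> 0"
  shows "refl_along u z \<noteq> z"
  using assms by (auto simp: refl_along_def)

lemma refl_along_swaps:
  assumes "norm x = norm y"
  shows "refl_along (x - y) x = y"
proof (cases "x = y")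
  case False
  have eq: "x \<bullet> x = y \<bullet> y"
    using assms by (simp add: norm_eq)
  have "(x - y) \<bullet> (x - y) = 2 * (x \<bullet> (x - y))"
    using eq by (simp add: inner_diff_left inner_diff_right inner_commute)
  moreover have "(x - y) \<bullet> (x - y) \<noteq> 0"
    using False by simp
  ultimately show ?thesis by (simp add: refl_along_def)
qed (simp add: refl_along_def)

lemma inner_refl_along: "refl_along u x \<bullet> y = x \<bullet> refl_along u y"
  by (simp add: refl_along_def inner_diff_left inner_diff_right inner_commute)

lemma inj_refl_along: "inj (refl_along u)"
  by (metis injI refl_along_involution)

section \<open>Connectedness\<close>

text \<open>Take a cut point \<open>v\<close> and a side \<open>A\<close> of it with as few points
  of \<open>V\<close> as possible, and some \<open>w\<close> in \<open>A\<close> and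
  \<open>V\<close>. Then \<open>K - A\<close> is connected and avoids \<open>w\<close>, so it lies
  on one side of \<open>w\<close>; the other side is contained in \<open>A - {w}\<close> and has
  fewer points of \<open>V\<close>.\<close>

lemma no_finite_set_of_cut_points:
  fixes K V :: "'a::metric_space set"
  assumes K: "connected K" and V: "finite V" "V \<noteq> {}" "V \<subseteq> K"
    and cut: "\<And>v. v \<in> V \<Longrightarrow> \<exists>A. openin (top_of_set (K - {v})) A \<and>
      closedin (top_of_set (K - {v})) A \<and> A \<inter> V \<noteq> {} \<and> (K - {v} - A) \<inter> V \<noteq> {}"
  shows False
proof -
  define side where "side v A \<longleftrightarrow> v \<in> V \<and> openin (top_of_set (K - {v})) A \<and>
      closedin (top_of_set (K - {v})) A \<and> A \<inter> V \<noteq> {} \<and> (K - {v} - A) \<inter> V \<noteq> {}" for v A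
  have side_compl: "side v (K - {v} - A)" if "side v A" for v A
  proof -
    have "A \<subseteq> K - {v}"
      using that openin_imp_subset unfolding side_def by blast
    then have "K - {v} - (K - {v} - A) = A" by blast
    then show ?thesis
      using that openin_diff[OF openin_subtopology_refl[THEN iffD2]]
        closedin_diff[OF closedin_subtopology_refl[THEN iffD2]]
      unfolding side_def by fastforce
  qed
  have "\<exists>p. side (fst p) (snd p)"
    using V(2) cut by (fastforce simp: side_def)
  then obtain p where p: "side (fst p) (snd p)"
    and min: "\<And>q. side (fst q) (snd q) \<Longrightarrow> card (snd p \<inter> V) \<le> card (snd q \<inter> V)"
    using exists_least_iff[of "\<lambda>n. \<exists>q. side (fst q) (snd q) \<and> card (snd q \<inter> V) = n"]
    by (metis linorder_not_le)
  obtain v A where [simp]: "p = (v, A)" by (cases p)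
  have vA: "side v A" using p by simp
  then obtain w where w: "w \<in> A" "w \<in> V" and Asub: "A \<subseteq> K - {v}" and v: "v \<in> V"
    using openin_imp_subset unfolding side_def by blast
  obtain A0 where A0: "side w A0"
    using cut[OF w(2)] w(2) by (auto simp: side_def)
  \<comment> \<open>Of the two sides of \<open>w\<close>, the one without \<open>v\<close> is the
    one that must avoid \<open>?B\<close> entirely.\<close>
  obtain A' where A': "side w A'" "v \<notin> A'"
    using A0 side_compl[OF A0] by (cases "v \<in> A0") auto
  have A'sub: "A' \<subseteq> K - {w}"
    using A'(1) openin_imp_subset unfolding side_def by blast
  let ?B = "{v} \<union> (K - {v} - A)"
  have "connected ?B"
    using side_compl[OF vA] K v V(3)
    by (intro connected_Un_clopen_in_complement[of "{v}" K]) (auto simp: side_def)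
  moreover have sub: "?B \<subseteq> K - {w}"
    using w Asub v V(3) by auto
  moreover have "openin (top_of_set ?B) (?B \<inter> A')" "closedin (top_of_set ?B) (?B \<inter> A')"
  proof -
    obtain S T where "open S" "A' = (K - {w}) \<inter> S" "closed T" "A' = (K - {w}) \<inter> T"
      using A'(1) unfolding side_def openin_open closedin_closed by blast
    moreover from this have "?B \<inter> A' = ?B \<inter> S" "?B \<inter> A' = ?B \<inter> T"
      using sub by blast+
    ultimately show "openin (top_of_set ?B) (?B \<inter> A')" "closedin (top_of_set ?B) (?B \<inter> A')"
      by (metis openin_open_Int, metis closedin_closed_Int)
  qed
  ultimately have "?B \<inter> A' = {} \<or> ?B \<inter> A' = ?B"
    unfolding connected_clopen by blast
  then have "A' \<inter> ?B = {}" using A'(2) by blast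
  then have "A' \<inter> V \<subset> A \<inter> V"
    using A'sub w by blast
  then have "card (A' \<inter> V) < card (A \<inter> V)"
    using V(1) by (intro psubset_card_mono) auto
  with min[of "(w, A')"] A'(1) show False by simp
qed

text \<open>A disconnection would split the compact set into two pieces at a positive distance
  \<open>d\<close>, and no chain with steps shorter than \<open>d\<close> passes from one to the
  other.\<close>

lemma connected_of_fine_chains:
  fixes K :: "'a::heine_borel set"
  assumes "compact K"
    and chain: "\<And>e x y. e > 0 \<Longrightarrow> x \<in> K \<Longrightarrow> y \<in> K \<Longrightarrow>
      (x, y) \<in> {(x, y). x \<in> K \<and> y \<in> K \<and> dist x y < e}\<^sup>*"
  shows "connected K"
proof (rule ccontr)
  assume "\<not> connected K"
  then obtain A B where AB: "closed A" "closed B" "K \<subseteq> A \<union> B" "A \<inter> B \<inter> K = {}"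
      "A \<inter> K \<noteq> {}" "B \<inter> K \<noteq> {}"
    by (auto simp: connected_closed)
  have "compact (K \<inter> A)" "closed (K \<inter> B)"
    using assms(1) AB by (auto intro: compact_Int_closed closed_Int compact_imp_closed)
  then obtain d where d: "d > 0" "\<And>x y. x \<in> K \<inter> A \<Longrightarrow> y \<in> K \<inter> B \<Longrightarrow> d \<le> dist x y"
    using separate_compact_closed[of "K \<inter> A" "K \<inter> B"] AB by blast
  obtain x y where x: "x \<in> A" "x \<in> K" and y: "y \<in> B" "y \<in> K" using AB by blast
  have "z \<in> A" if "(x, z) \<in> {(x, y). x \<in> K \<and> y \<in> K \<and> dist x y < d}\<^sup>*" for z
    using that
  proof (induction rule: rtrancl_induct)
    case (step u z)
    then show ?case using d(2)[of u z] AB(3) by force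
  qed (rule x)
  then have "y \<in> A" using chain[OF d(1) x(2) y(2)] by blast
  then show False using AB(4) y by blast
qed

section \<open>Mirrors and cells\<close>

text \<open>This is the fractal with the barycenter moved to 0. Cells are recorded by their
  translations \<open>a\<close>, since scaling by \<open>L\<close> turns the cell into the translate
  \<open>K + a\<close>. All mirrors pass through 0 and are given by normals \<open>x - y\<close>. In
  \<open>corner\<close>, the cell with translation \<open>(L - 1) *\<^sub>R v\<close> is the one
  whose contraction fixes \<open>v\<close>.\<close>

locale centered_snf =
  fixes L :: real and A V K :: "'a::euclidean_space set"
  assumes L: "L > 1"
    and compact_K: "compact K" and K_ne: "K \<noteq> {}"
    and K_eq: "K = (\<Union>a\<in>A. (\<lambda>z. (z + a) /\<^sub>R L) ` K)"
    and finite_V: "finite V"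
    and V_sub: "V \<subseteq> K"
    and corner: "\<And>v. v \<in> V \<Longrightarrow> (L - 1) *\<^sub>R v \<in> A"
    and nesting: "\<And>a a' p p'. a \<in> A \<Longrightarrow> a' \<in> A \<Longrightarrow> a \<noteq> a' \<Longrightarrow> p \<in> K \<Longrightarrow> p' \<in> K \<Longrightarrow>
      p + a = p' + a' \<Longrightarrow> p \<in> V \<and> p' \<in> V"
    and sphere: "\<And>x y. x \<in> V \<Longrightarrow> y \<in> V \<Longrightarrow> norm x = norm y"
    and refl_V: "\<And>x y z. x \<in> V \<Longrightarrow> y \<in> V \<Longrightarrow> x \<noteq> y \<Longrightarrow> z \<in> V \<Longrightarrow> refl_along (x - y) z \<in> V"
    and refl_A: "\<And>x y a. x \<in> V \<Longrightarrow> y \<in> V \<Longrightarrow> x \<noteq> y \<Longrightarrow> a \<in> A \<Longrightarrow> refl_along (x - y) a \<in> A"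
    and adjacent: "\<And>a a'. a \<in> A \<Longrightarrow> a' \<in> A \<Longrightarrow>
      (a, a') \<in> {(a, a'). a \<in> A \<and> a' \<in> A \<and> (\<exists>p\<in>K. \<exists>p'\<in>K. p + a = p' + a')}\<^sup>*"
begin

section \<open>Symmetry and connectedness of the invariant set\<close>

lemma cell_in_K: "z \<in> K \<Longrightarrow> a \<in> A \<Longrightarrow> (z + a) /\<^sub>R L \<in> K"
  using K_eq by blast

lemma K_cases:
  assumes "z \<in> K"
  obtains a z' where "a \<in> A" "z' \<in> K" "z = (z' + a) /\<^sub>R L"
  using assms K_eq by blast

text \<open>Let \<open>w\<close> be a point of \<open>K\<close> whose reflection is farthest from
  \<open>K\<close>. The mirror maps the cell of \<open>w\<close> to another cell, so by
  self-similarity this maximal distance is at most \<open>1 / L\<close> times itself, hence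
  0.\<close>

lemma refl_K:
  assumes xy: "x \<in> V" "y \<in> V" "x \<noteq> y" and z: "z \<in> K"
  shows "refl_along (x - y) z \<in> K"
proof -
  let ?R = "refl_along (x - y)"
  have cont: "continuous_on K (\<lambda>z. infdist (?R z) K)"
    by (intro continuous_intros linear_continuous_on_compose[OF _ linear_refl_along])
  obtain w where w: "w \<in> K" and max: "\<And>z. z \<in> K \<Longrightarrow> infdist (?R z) K \<le> infdist (?R w) K"
    using continuous_attains_sup[OF compact_K K_ne cont] by blast
  obtain a w' where aw: "a \<in> A" "w' \<in> K" "w = (w' + a) /\<^sub>R L"
    using K_cases[OF w] .
  obtain q where q: "q \<in> K" "infdist (?R w') K = dist (?R w') q"
    using infdist_attains_inf[OF compact_imp_closed[OF compact_K] K_ne] by blast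
  have "?R w = (?R w' + ?R a) /\<^sub>R L"
    by (simp add: aw(3) linear_scale[OF linear_refl_along] linear_add[OF linear_refl_along])
  then have "dist (?R w) ((q + ?R a) /\<^sub>R L) = dist (?R w') q / L"
    using L by (simp add: dist_norm flip: scaleR_diff_right) (simp add: divide_inverse)
  moreover have "(q + ?R a) /\<^sub>R L \<in> K"
    using q(1) refl_A[OF xy aw(1)] by (rule cell_in_K)
  ultimately have "infdist (?R w) K \<le> infdist (?R w') K / L"
    using q(2) infdist_le[of _ K "?R w"] by metis
  also have "\<dots> \<le> infdist (?R w) K / L"
    using max[OF aw(2)] L by (simp add: divide_right_mono)
  finally have "infdist (?R w) K * (L - 1) \<le> 0"
    using L by (simp add: field_simps)
  then have "infdist (?R w) K \<le> 0"
    using L by (simp add: mult_le_0_iff)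
  then have "infdist (?R z) K = 0"
    using max[OF z] infdist_nonneg[of "?R z" K] by linarith
  then show ?thesis
    using in_closed_iff_infdist_zero[OF compact_imp_closed[OF compact_K] K_ne] by blast
qed

text \<open>Chains of step \<open>e\<close> in \<open>K\<close> shrink to chains of step
  \<open>e / L\<close> inside each cell, and adjacent cells have common points where such chains are
  joined. Starting above the diameter, iteration reaches arbitrarily fine chains.\<close>

lemma connected_K: "connected K"
proof (rule connected_of_fine_chains[OF compact_K])
  define D where "D e = {(x, y). x \<in> K \<and> y \<in> K \<and> dist x y < e}" for e
  define linked where "linked e \<longleftrightarrow> (\<forall>x\<in>K. \<forall>y\<in>K. (x, y) \<in> (D e)\<^sup>*)" for e
  obtain e0 where e0: "e0 > 0" "linked e0"
  proof -
    have "linked (diameter K + 1)"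
      using diameter_bounded_bound[OF compact_imp_bounded[OF compact_K]]
      by (fastforce simp: linked_def D_def)
    moreover have "diameter K + 1 > 0"
      using diameter_ge_0[OF compact_imp_bounded[OF compact_K]] by linarith
    ultimately show thesis using that by blast
  qed
  have shrink: "linked (e / L)" if e: "linked e" for e
  proof -
    have cell: "((x + a) /\<^sub>R L, (y + a) /\<^sub>R L) \<in> (D (e / L))\<^sup>*"
      if "x \<in> K" "y \<in> K" "a \<in> A" for x y a
    proof -
      have "(x, y) \<in> (D e)\<^sup>*" using e that by (simp add: linked_def)
      then show ?thesis
      proof (induction rule: rtrancl_induct)
        case (step u v)
        have "dist ((u + a) /\<^sub>R L) ((v + a) /\<^sub>R L) = dist u v / L"
          using L by (simp add: dist_norm flip: scaleR_diff_right) (simp add: divide_inverse)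
        then have "((u + a) /\<^sub>R L, (v + a) /\<^sub>R L) \<in> D (e / L)"
          using step(2) cell_in_K[OF _ that(3)] L by (simp add: D_def divide_strict_right_mono)
        then show ?case using step(3) by simp
      qed simp
    qed
    have "\<forall>x\<in>K. \<forall>y\<in>K. ((x + a) /\<^sub>R L, (y + a') /\<^sub>R L) \<in> (D (e / L))\<^sup>*"
      if "a \<in> A" "a' \<in> A" for a a'
      using adjacent[OF that]
    proof (induction rule: rtrancl_induct)
      case base
      then show ?case using cell that by blast
    next
      case (step b c)
      then obtain p p' where "p \<in> K" "p' \<in> K" "p + b = p' + c" "c \<in> A" by blast
      then show ?case
        using step.IH cell[of p' _ c] by (metis rtrancl_trans)
    qed
    then show ?thesis
      unfolding linked_def by (metis K_cases)
  qed
  fix e :: real and x y assume e: "e > 0" and x: "x \<in> K" "y \<in> K"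
  have "linked (e0 / L ^ n)" for n
  proof (induction n)
    case (Suc n)
    then show ?case using shrink[of "e0 / L ^ n"] by (simp add: mult.commute)
  qed (simp add: e0)
  moreover obtain n where "e0 / e < L ^ n"
    using real_arch_pow[OF L] by blast
  then have "e0 / L ^ n < e"
    using L e by (simp add: field_simps)
  ultimately have "(x, y) \<in> (D (e0 / L ^ n))\<^sup>*" and "D (e0 / L ^ n) \<subseteq> D e"
    using x by (auto simp: linked_def D_def)
  then have "(x, y) \<in> (D e)\<^sup>*" using rtrancl_mono by blast
  then show "(x, y) \<in> {(x, y). x \<in> K \<and> y \<in> K \<and> dist x y < e}\<^sup>*"
    by (simp add: D_def)
qed

section \<open>Hyperplanes that meet the fractal only in vertices\<close>

lemma hyperplane_section_singleton:
  assumes sec: "\<And>p. p \<in> K \<Longrightarrow> p \<bullet> u = \<beta> \<Longrightarrow> p \<in> V"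
    and p: "p \<in> K" "p \<bullet> u = \<beta>" and q: "q \<in> K" "q \<bullet> u = \<beta>"
  shows "q = p"
proof -
  have V: "p \<in> V" "q \<in> V" using sec p q by auto
  \<comment> \<open>The contraction fixing \<open>p\<close> sends \<open>q\<close> to
    \<open>s\<close>, which would be strictly between \<open>p\<close> and \<open>q\<close>. It lies
    in \<open>K\<close> and on the hyperplane, so it is a vertex; but three points of a sphere are
    never collinear.\<close>
  define s where "s = (q + (L - 1) *\<^sub>R p) /\<^sub>R L"
  have s_eq: "s = p + (q - p) /\<^sub>R L"
    using L by (simp add: s_def algebra_simps)
  have "s \<in> K"
    unfolding s_def using q(1) corner[OF V(1)] by (rule cell_in_K)
  moreover have "s \<bullet> u = \<beta>"
    using p q by (simp add: s_eq inner_add_left inner_diff_left)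
  ultimately have "s \<in> V" by (rule sec)
  then have "s \<bullet> s = p \<bullet> p" "q \<bullet> q = p \<bullet> p"
    using sphere[of s p] sphere[of q p] V by (auto simp: norm_eq)
  moreover have "q = p + (q - p)" by simp
  ultimately have "2 * (p \<bullet> (q - p)) / L + (q - p) \<bullet> (q - p) / L\<^sup>2 = 0"
      "2 * (p \<bullet> (q - p)) + (q - p) \<bullet> (q - p) = 0"
    by (simp_all add: s_eq inner_add_left inner_add_right inner_diff_left inner_diff_right
        inner_commute power2_eq_square divide_inverse algebra_simps)
  \<comment> \<open>Eliminating \<open>p \<bullet> (q - p)\<close> from the two sphere equations
    leaves only the squared length of \<open>q - p\<close>.\<close>
  then have "- ((q - p) \<bullet> (q - p)) / L + (q - p) \<bullet> (q - p) / L\<^sup>2 = 0"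
    by (metis add_eq_0_iff2)
  then have "((q - p) \<bullet> (q - p)) * (1 - L) = 0"
    using L by (simp only: power2_eq_square) (simp add: field_simps del: inner_eq_zero_iff)
  then show ?thesis using L by simp
qed

text \<open>Connectedness forces the hyperplane to meet \<open>K\<close>, and it does so in a single
  vertex \<open>p\<close>, which therefore separates vertices from each other. The mirror exchanging
  \<open>p\<close> with any other vertex carries this property over, contradicting
  \<open>no_finite_set_of_cut_points\<close>.\<close>

lemma hyperplane_section_one_side:
  assumes sec: "\<And>p. p \<in> K \<Longrightarrow> p \<bullet> u = \<beta> \<Longrightarrow> p \<in> V"
    and V12: "v1 \<in> V" "v2 \<in> V" "v1 \<bullet> u < \<beta>" "\<beta> < v2 \<bullet> u"
  shows False
proof -
  obtain p where p: "p \<in> K" "p \<bullet> u = \<beta>"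
    using connected_ivt_hyperplane[OF connected_K, of v1 v2 u \<beta>] V12 V_sub
    by (auto simp: inner_commute)
  have pV: "p \<in> V" using sec p .
  have single: "q = p" if "q \<in> K" "q \<bullet> u = \<beta>" for q
    using hyperplane_section_singleton[of u \<beta> p q] sec p that by blast
  have cut: "\<exists>B. openin (top_of_set (K - {w})) B \<and> closedin (top_of_set (K - {w})) B \<and>
      B \<inter> V \<noteq> {} \<and> (K - {w} - B) \<inter> V \<noteq> {}" if w: "w \<in> V" for w
  proof -
    obtain n where n: "\<And>q. q \<in> K \<Longrightarrow> q \<bullet> n = \<beta> \<Longrightarrow> q = w" "w \<bullet> n = \<beta>"
        "\<exists>v\<in>V. v \<bullet> n < \<beta>" "\<exists>v\<in>V. \<beta> < v \<bullet> n"
    proof (cases "w = p")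
      case True
      then show thesis using that[of u] single p V12 by blast
    next
      case False
      \<comment> \<open>Reflecting the normal moves the hyperplane through \<open>p\<close> to one
        through \<open>w\<close>, because \<open>?R\<close> is a self-adjoint involution;
        \<open>K\<close> and \<open>V\<close> are invariant.\<close>
      let ?R = "refl_along (p - w)"
      have Rp: "?R p = w" using refl_along_swaps sphere pV w by blast
      show thesis
      proof (rule that[of "?R u"])
        fix q assume q: "q \<in> K" "q \<bullet> ?R u = \<beta>"
        then have "?R q = p"
          using refl_K[OF pV w] False by (intro single) (auto simp: inner_refl_along)
        then show "q = w" using Rp refl_along_involution by metis
      next
        show "w \<bullet> ?R u = \<beta>"
          using Rp p by (metis inner_refl_along refl_along_involution)
        show "\<exists>v\<in>V. v \<bullet> ?R u < \<beta>" "\<exists>v\<in>V. \<beta> < v \<bullet> ?R u"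
          using V12 refl_V[OF pV w] False
          by (metis inner_refl_along refl_along_involution)+
      qed
    qed
    let ?B = "(K - {w}) \<inter> {z. n \<bullet> z < \<beta>}"
    have "openin (top_of_set (K - {w})) ?B"
      by (intro openin_open_Int open_halfspace_lt)
    \<comment> \<open>Only \<open>w\<close> lies on the hyperplane, so the open and the closed
      half-space cut out the same part of \<open>K - {w}\<close>, which is thus clopen.\<close>
    moreover have "?B = (K - {w}) \<inter> {z. n \<bullet> z \<le> \<beta>}"
      using n(1) by (force simp: inner_commute)
    then have "closedin (top_of_set (K - {w})) ?B"
      by (metis closedin_closed_Int closed_halfspace_le)
    moreover have "?B \<inter> V \<noteq> {}" "(K - {w} - ?B) \<inter> V \<noteq> {}"
      using n V_sub by (force simp: inner_commute)+
    ultimately show ?thesis by blast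
  qed
  show False
    using no_finite_set_of_cut_points[OF connected_K finite_V _ V_sub cut] pV by blast
qed

text \<open>A point \<open>p + a\<close> on the mirror lies in the cell and in its mirror image,
  which are distinct by \<open>ne\<close>, so nesting makes \<open>p\<close> a vertex. In the
  coordinates of the cell the mirror is the hyperplane at level
  \<open>- (a \<bullet> (x - y))\<close>, and it must not separate \<open>v\<close> from its
  reflection.\<close>

lemma mirror_misses_cell:
  assumes a: "a \<in> A" and V: "x \<in> V" "y \<in> V" "v \<in> V" and ne: "a \<bullet> (x - y) \<noteq> 0"
  shows "\<bar>v \<bullet> (x - y)\<bar> \<le> \<bar>a \<bullet> (x - y)\<bar>"
proof (rule ccontr)
  assume less: "\<not> ?thesis"
  let ?R = "refl_along (x - y)" and ?\<beta> = "- (a \<bullet> (x - y))"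
  have xy: "x \<noteq> y" using ne by auto
  have sec: "p \<in> V" if p: "p \<in> K" "p \<bullet> (x - y) = ?\<beta>" for p
  proof -
    have "?R (p + a) = p + a"
      using p by (intro refl_along_fixed) (simp add: inner_add_left)
    then have "p + a = ?R p + ?R a"
      by (simp add: linear_add[OF linear_refl_along])
    then show ?thesis
      using nesting[OF a refl_A[OF V(1,2) xy a] _ p(1) refl_K[OF V(1,2) xy p(1)]]
        refl_along_moves[OF ne] by metis
  qed
  have "?R v \<in> V" "?R v \<bullet> (x - y) = - (v \<bullet> (x - y))"
    using refl_V[OF V(1,2) xy V(3)] by (simp_all add: refl_along_inner_normal)
  then show False
    using hyperplane_section_one_side[of "x - y" ?\<beta> v "?R v"]
      hyperplane_section_one_side[of "x - y" ?\<beta> "?R v" v] sec V(3) less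
    by (auto simp: abs_if split: if_splits)
qed

text \<open>If 0 lies in a cell with \<open>a \<noteq> 0\<close>, a mirror moving \<open>a\<close>
  fixes 0, so 0 lies in two cells and is a vertex of the first. Otherwise a cell is centered at 0;
  the corner cell at \<open>v\<close> is another one, so connectivity provides a neighbor touching
  the central cell in a common vertex.\<close>

lemma cell_translations_of_center:
  assumes "0 \<in> K" and span: "\<And>a. a \<noteq> 0 \<Longrightarrow> \<exists>x\<in>V. \<exists>y\<in>V. a \<bullet> (x - y) \<noteq> 0"
    and v: "v \<in> V" "v \<noteq> 0"
  shows "\<exists>a\<in>A. a \<noteq> 0 \<and> (- a \<in> V \<or> (\<exists>v\<in>V. \<exists>w\<in>V. a = v - w))"
proof -
  obtain a z where az: "a \<in> A" "z \<in> K" "0 = (z + a) /\<^sub>R L"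
    using K_cases[OF assms(1)] .
  then have za: "z + a = 0" using L by simp
  show ?thesis
  proof (cases "a = 0")
    case False
    then obtain x y where xy: "x \<in> V" "y \<in> V" "a \<bullet> (x - y) \<noteq> 0" using span by blast
    then have ne: "x \<noteq> y" by auto
    have "refl_along (x - y) z + refl_along (x - y) a = 0"
      using za by (simp add: linear_0[OF linear_refl_along]
          flip: linear_add[OF linear_refl_along])
    then have "z \<in> V"
      using nesting[OF az(1) refl_A[OF xy(1,2) ne az(1)] _ az(2) refl_K[OF xy(1,2) ne az(2)]]
        refl_along_moves[OF xy(3)] za by metis
    moreover have "z = - a" using za by (simp add: eq_neg_iff_add_eq_0)
    ultimately show ?thesis using az(1) False by blast
  next
    case True
    \<comment> \<open>A chain of cells that leaves the central cell contains a link from translation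
      0 to a nonzero one.\<close>
    have "b = 0 \<or> (\<exists>c\<in>A. c \<noteq> 0 \<and> (\<exists>p\<in>K. \<exists>p'\<in>K. p = p' + c))"
      if "(0, b) \<in> {(a, a'). a \<in> A \<and> a' \<in> A \<and> (\<exists>p\<in>K. \<exists>p'\<in>K. p + a = p' + a')}\<^sup>*" for b
      using that
    proof (induction rule: rtrancl_induct)
      case (step b c)
      then show ?case by (cases "b = 0"; cases "c = 0") auto
    qed simp
    moreover have "(L - 1) *\<^sub>R v \<in> A" "(L - 1) *\<^sub>R v \<noteq> 0"
      using corner v L by auto
    ultimately obtain c p p' where c: "c \<in> A" "c \<noteq> 0" "p \<in> K" "p' \<in> K" "p = p' + c"
      using adjacent[of 0 "(L - 1) *\<^sub>R v"] az(1) True by blast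
    then have "p \<in> V" "p' \<in> V"
      using nesting[of 0 c p p'] az(1) True by auto
    then show ?thesis using c by (metis add_diff_cancel_left')
  qed
qed

end

section \<open>Centering at the barycenter of the essential fixed points\<close>

lemma barycenter_affine_image:
  assumes g: "linear g" "inj g" and X: "finite X" "X \<noteq> {}"
  shows "barycenter ((\<lambda>x. g x + t) ` X) = g (barycenter X) + t"
proof -
  have inj: "inj_on (\<lambda>x. g x + t) X"
    using g(2) by (auto simp: inj_on_def)
  have "card X \<noteq> 0" using X by simp
  then show ?thesis
    using inj by (simp add: barycenter_def card_image sum.reindex sum.distrib scaleR_add_right
        linear_sum[OF g(1)] linear_scale[OF g(1)])
      (simp add: sum_constant_scaleR)
qed

lemma bisector_reflection_affine:
  "bisector_reflection x y z = refl_along (x - y) z + bisector_reflection x y 0"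
proof -
  define u where "u = x - y"
  have yx: "y - x = - u" by (simp add: u_def)
  show ?thesis
    unfolding bisector_reflection_def refl_along_def yx u_def[symmetric]
    by (simp add: inner_diff_left diff_divide_distrib algebra_simps power2_norm_eq_inner)
qed

locale snf =
  fixes L :: real and N :: nat and \<nu> :: "nat \<Rightarrow> 'a::euclidean_space" and K V :: "'a set" and b :: 'a
  assumes snf: "simple_nested_fractal L N \<nu> K"
    and V_eq: "V = essential_fixed_points L N \<nu>"
    and b_eq: "b = barycenter V"
begin

lemma L: "L > 1" and compact_K: "compact K" and K_ne: "K \<noteq> {}"
  and K_eq: "K = (\<Union>i\<in>{1..N}. sim L \<nu> i ` K)"
  and card_V: "card V \<ge> 2"
  using snf by (simp_all add: simple_nested_fractal_def V_eq)

lemma nesting: "i \<in> {1..N} \<Longrightarrow> j \<in> {1..N} \<Longrightarrow> i \<noteq> j \<Longrightarrow>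
    sim L \<nu> i ` K \<inter> sim L \<nu> j ` K = sim L \<nu> i ` V \<inter> sim L \<nu> j ` V"
  using snf by (simp add: simple_nested_fractal_def V_eq)

lemma symmetry: "i \<in> {1..N} \<Longrightarrow> x \<in> V \<Longrightarrow> y \<in> V \<Longrightarrow> x \<noteq> y \<Longrightarrow>
    \<exists>j\<in>{1..N}. bisector_reflection x y ` sim L \<nu> i ` V = sim L \<nu> j ` V"
  using snf by (simp add: simple_nested_fractal_def V_eq)

lemma connectivity: "x \<in> cell_vertices L N \<nu> \<Longrightarrow> y \<in> cell_vertices L N \<nu> \<Longrightarrow>
    (x, y) \<in> (cell_graph L N \<nu> K)\<^sup>*"
  using snf by (simp add: simple_nested_fractal_def)

lemma finite_V: "finite V" and V_ne: "V \<noteq> {}"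
  using card_V card.infinite by fastforce+

lemma inj_sim: "inj (sim L \<nu> i)"
  using L by (auto simp: inj_def sim_def)

lemma sim_diff: "sim L \<nu> i z - sim L \<nu> i z' = (z - z') /\<^sub>R L"
  by (simp add: sim_def scaleR_diff_right)

lemma sim_in_K: "i \<in> {1..N} \<Longrightarrow> z \<in> K \<Longrightarrow> sim L \<nu> i z \<in> K"
  using K_eq by blast

text \<open>The map brings the point of \<open>K\<close> nearest to \<open>x\<close> closer to
  \<open>x\<close> by the factor \<open>1 / L\<close> without leaving \<open>K\<close>.\<close>

lemma fixed_point_in_K:
  assumes i: "i \<in> {1..N}" and x: "sim L \<nu> i x = x"
  shows "x \<in> K"
proof -
  obtain y where y: "y \<in> K" "\<And>z. z \<in> K \<Longrightarrow> dist x y \<le> dist x z"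
    using distance_attains_inf[OF compact_imp_closed[OF compact_K] K_ne] by blast
  have "dist x y \<le> dist (sim L \<nu> i x) (sim L \<nu> i y)"
    using y(2)[OF sim_in_K[OF i y(1)]] x by simp
  also have "\<dots> = dist x y / L"
    using L by (simp add: dist_norm sim_diff divide_inverse)
  finally have "dist x y * (L - 1) \<le> 0" using L by (simp add: field_simps)
  then have "dist x y = 0" using L by (simp add: mult_le_0_iff)
  then show ?thesis using y(1) by simp
qed

lemma V_fixed: "v \<in> V \<Longrightarrow> \<exists>i\<in>{1..N}. sim L \<nu> i v = v"
  by (auto simp: V_eq essential_fixed_points_def fixed_points_def)

lemma V_sub: "V \<subseteq> K"
  using V_fixed fixed_point_in_K by blast

lemma barycenter_sim: "barycenter (sim L \<nu> i ` V) = sim L \<nu> i b"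
  using L barycenter_affine_image[of "\<lambda>x. x /\<^sub>R L" V "\<nu> i"] finite_V V_ne
  by (simp add: sim_def[abs_def] b_eq linear_scaleR inj_def)

text \<open>The symmetry condition speaks of vertex sets of cells; taking barycenters turns it into
  a statement on cell centers. Subtracting the centers shows that the linear part of the reflection,
  applied around \<open>b\<close>, preserves \<open>V\<close>. That the mirror itself passes through
  \<open>b\<close> is not yet available here.\<close>

lemma symmetry_barycenter:
  assumes i: "i \<in> {1..N}" and xy: "x \<in> V" "y \<in> V" "x \<noteq> y"
  shows "\<exists>j\<in>{1..N}. bisector_reflection x y (sim L \<nu> i b) = sim L \<nu> j b \<and>
    (\<forall>v\<in>V. b + refl_along (x - y) (v - b) \<in> V)"
proof -
  let ?S = "bisector_reflection x y"
  obtain j where j: "j \<in> {1..N}" "?S ` sim L \<nu> i ` V = sim L \<nu> j ` V"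
    using symmetry[OF i xy] by blast
  have "?S = (\<lambda>z. refl_along (x - y) z + ?S 0)"
    using bisector_reflection_affine by blast
  then have "barycenter (?S ` sim L \<nu> i ` V) = ?S (barycenter (sim L \<nu> i ` V))"
    using barycenter_affine_image[OF linear_refl_along inj_refl_along, of "sim L \<nu> i ` V"]
      finite_V V_ne by (metis finite_imageI image_is_empty)
  then have Sb: "?S (sim L \<nu> i b) = sim L \<nu> j b"
    by (simp add: barycenter_sim j)
  have "b + refl_along (x - y) (v - b) \<in> V" if v: "v \<in> V" for v
  proof -
    obtain v' where v': "v' \<in> V" "?S (sim L \<nu> i v) = sim L \<nu> j v'"
      using j(2) v by blast
    have "(v' - b) /\<^sub>R L = ?S (sim L \<nu> i v) - ?S (sim L \<nu> i b)"
      by (simp add: v' Sb sim_diff)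
    also have "\<dots> = refl_along (x - y) (sim L \<nu> i v - sim L \<nu> i b)"
      by (subst (1 2) bisector_reflection_affine)
        (simp add: linear_diff[OF linear_refl_along])
    also have "\<dots> = refl_along (x - y) (v - b) /\<^sub>R L"
      by (simp add: sim_diff linear_scale[OF linear_refl_along])
    finally have "v' - b = refl_along (x - y) (v - b)" using L by simp
    then show ?thesis using v'(1) by (simp flip: \<open>v' - b = _\<close>)
  qed
  then show ?thesis using j(1) Sb by blast
qed

text \<open>The reflections permute the cells, hence fix the mean \<open>c\<close> of the cell centers, so \<open>V\<close> lies on
  a sphere around \<open>c\<close>.  The reflection through \<open>b\<close> parallel to \<open>bisector_reflection x y\<close> preserves
  \<open>V\<close>, and so \<open>V\<close> lies on a sphere around the image of \<open>c\<close> as well; this forces \<open>c - b\<close> to be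
  orthogonal to \<open>x - y\<close>.\<close>

lemma dist_barycenter:
  assumes xy: "x \<in> V" "y \<in> V"
  shows "dist x b = dist y b"
proof (cases "x = y")
  case False
  define T where "T = (\<lambda>i. sim L \<nu> i b) ` {1..N}"
  define c where "c = barycenter T"
  have T: "finite T" "T \<noteq> {}"
    using V_fixed V_ne by (auto simp: T_def)
  have eq: "dist p c = dist q c" if pq: "p \<in> V" "q \<in> V" for p q
  proof (cases "p = q")
    case False
    let ?S = "bisector_reflection p q"
    have S: "?S = (\<lambda>z. refl_along (p - q) z + ?S 0)"
      using bisector_reflection_affine by blast
    have "?S ` T \<subseteq> T"
      using symmetry_barycenter[OF _ pq False] by (fastforce simp: T_def)
    moreover have "inj ?S"
      using inj_refl_along[of "p - q"] by (subst S) (simp add: inj_def)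
    ultimately have "?S ` T = T"
      using endo_inj_surj[OF T(1)] inj_on_subset by blast
    then have "?S c = c"
      using barycenter_affine_image[OF linear_refl_along inj_refl_along T, of "p - q" "?S 0"]
      by (simp add: c_def flip: S bisector_reflection_affine)
    then show ?thesis using bisector_reflection_fixed_iff[OF False] by blast
  qed simp
  define u e where "u = x - y" and "e = c - b"
  let ?R = "refl_along u"
  have V_norm: "norm (p - b - e) = norm (q - b - e)" if "p \<in> V" "q \<in> V" for p q
    using eq[OF that] by (simp add: dist_norm e_def)
  have "norm (p - b - ?R e) = norm (?R (p - b) - e)" for p
    by (metis linear_diff[OF linear_refl_along] norm_refl_along refl_along_involution)
  moreover have "b + ?R (p - b) \<in> V" if "p \<in> V" for p
  proof -
    obtain i where "i \<in> {1..N}" using V_fixed[OF xy(1)] by blast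
    then show ?thesis using symmetry_barycenter[OF _ xy False] that by (auto simp: u_def)
  qed
  ultimately have "norm (x - b - ?R e) = norm (y - b - ?R e)"
    using V_norm[of "b + ?R (x - b)" "b + ?R (y - b)"] xy by simp
  moreover have "norm (x - b - e) = norm (y - b - e)" using V_norm xy by blast
  moreover have expand: "p \<bullet> p - 2 * (p \<bullet> q) = p' \<bullet> p' - 2 * (p' \<bullet> q)"
    if "norm (p - q) = norm (p' - q)" for p p' q :: 'a
    using that by (simp add: norm_eq inner_diff_left inner_diff_right inner_commute)
  ultimately have *: "(x - b) \<bullet> (x - b) - 2 * ((x - b) \<bullet> ?R e) = (y - b) \<bullet> (y - b) - 2 * ((y - b) \<bullet> ?R e)"
      "(x - b) \<bullet> (x - b) - 2 * ((x - b) \<bullet> e) = (y - b) \<bullet> (y - b) - 2 * ((y - b) \<bullet> e)"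
    using expand by blast+
  have "u \<bullet> ?R e = u \<bullet> e"
    using * unfolding u_def by (simp add: inner_diff_left)
  moreover have "u \<bullet> ?R e = - (u \<bullet> e)"
    using refl_along_inner_normal[of u e] by (simp add: inner_commute)
  ultimately have "u \<bullet> e = 0" by simp
  then have "(x - b) \<bullet> (x - b) = (y - b) \<bullet> (y - b)"
    using *(2) by (simp add: u_def inner_diff_left)
  then show ?thesis by (simp add: dist_norm norm_eq)
qed simp

text \<open>By \<open>dist_barycenter\<close> the bisector contains \<open>b\<close>, so the
  translation part vanishes in coordinates centered at \<open>b\<close>.\<close>

lemma bisector_reflection_center:
  assumes "x \<in> V" "y \<in> V" "x \<noteq> y"
  shows "bisector_reflection x y z = b + refl_along (x - y) (z - b)"
proof -
  have "bisector_reflection x y b = b"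
    using bisector_reflection_fixed_iff[OF assms(3)] dist_barycenter[OF assms(1,2)] by blast
  then show ?thesis
    using bisector_reflection_affine[of x y z] bisector_reflection_affine[of x y b]
    by (simp add: linear_diff[OF linear_refl_along] algebra_simps)
qed

text \<open>Chosen so that in coordinates centered at \<open>b\<close> the map number
  \<open>i\<close> becomes addition of \<open>shift i\<close> followed by division by
  \<open>L\<close>.\<close>

definition shift :: "nat \<Rightarrow> 'a" where "shift i = b + L *\<^sub>R \<nu> i - L *\<^sub>R b"

lemma sim_shift: "sim L \<nu> i z - b = (z - b + shift i) /\<^sub>R L"
  using L by (simp add: sim_def shift_def algebra_simps)

text \<open>The connectivity condition links points, whereas here cells are linked. Each edge lies
  in one cell, and the cells of consecutive edges share a point.\<close>

lemma cells_linked: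
  assumes "i \<in> {1..N}" "j \<in> {1..N}"
  shows "(shift i, shift j) \<in> {(a, a'). a \<in> shift ` {1..N} \<and> a' \<in> shift ` {1..N} \<and>
    (\<exists>p\<in>(\<lambda>x. x - b) ` K. \<exists>p'\<in>(\<lambda>x. x - b) ` K. p + a = p' + a')}\<^sup>*" (is "_ \<in> ?E\<^sup>*")
proof -
  have meet: "(shift i, shift j) \<in> ?E"
    if "i \<in> {1..N}" "j \<in> {1..N}" "x \<in> sim L \<nu> i ` K" "x \<in> sim L \<nu> j ` K" for i j x
  proof -
    obtain p p' where p: "p \<in> K" "p' \<in> K" "x = sim L \<nu> i p" "x = sim L \<nu> j p'"
      using \<open>x \<in> sim L \<nu> i ` K\<close> \<open>x \<in> sim L \<nu> j ` K\<close> by blast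
    then have "(p - b + shift i) /\<^sub>R L = (p' - b + shift j) /\<^sub>R L"
      using sim_shift by metis
    then have "(p - b) + shift i = (p' - b) + shift j" using L by simp
    then show ?thesis using p that by blast
  qed
  obtain v where v: "v \<in> V" using V_ne by blast
  have "(sim L \<nu> i v, sim L \<nu> j v) \<in> (cell_graph L N \<nu> K)\<^sup>*"
    using assms v unfolding V_eq by (intro connectivity) (auto simp: cell_vertices_def)
  \<comment> \<open>The invariant covers every cell containing the current point, since the next
    edge may continue in any of them.\<close>
  then have "\<forall>m\<in>{1..N}. sim L \<nu> j v \<in> sim L \<nu> m ` K \<longrightarrow> (shift i, shift m) \<in> ?E\<^sup>*"
  proof (induction rule: rtrancl_induct)
    case base
    have "sim L \<nu> i v \<in> sim L \<nu> i ` K" using v V_sub by blast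
    then show ?case using meet[OF assms(1)] by (intro ballI impI r_into_rtrancl)
  next
    case (step x y)
    then obtain l where l: "l \<in> {1..N}" "x \<in> sim L \<nu> l ` K" "y \<in> sim L \<nu> l ` K"
      by (auto simp: cell_graph_def)
    then have "(shift i, shift l) \<in> ?E\<^sup>*" using step.IH by blast
    then show ?case using meet[OF l(1) _ l(3)] by (meson rtrancl.rtrancl_into_rtrancl)
  qed
  then show ?thesis using assms(2) v V_sub by blast
qed

lemma centered: "centered_snf L (shift ` {1..N}) ((\<lambda>x. x - b) ` V) ((\<lambda>x. x - b) ` K)"
proof
  show "L > 1" by (rule L)
  show "compact ((\<lambda>x. x - b) ` K)"
    using compact_K by (intro compact_continuous_image continuous_intros)
  show "(\<lambda>x. x - b) ` K \<noteq> {}" using K_ne by simp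
  have "(\<lambda>x. x - b) ` K = (\<lambda>x. x - b) ` (\<Union>i\<in>{1..N}. sim L \<nu> i ` K)"
    using K_eq by (rule arg_cong)
  also have "\<dots> = (\<Union>a\<in>shift ` {1..N}. (\<lambda>z. (z + a) /\<^sub>R L) ` (\<lambda>x. x - b) ` K)"
    by (simp add: image_UN image_image sim_shift)
  finally show "(\<lambda>x. x - b) ` K =
      (\<Union>a\<in>shift ` {1..N}. (\<lambda>z. (z + a) /\<^sub>R L) ` (\<lambda>x. x - b) ` K)" .
  show "finite ((\<lambda>x. x - b) ` V)" using finite_V by simp
  show "(\<lambda>x. x - b) ` V \<subseteq> (\<lambda>x. x - b) ` K" using V_sub by blast
next
  fix v assume "v \<in> (\<lambda>x. x - b) ` V"
  then obtain x i where x: "v = x - b" "i \<in> {1..N}" "sim L \<nu> i x = x"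
    using V_fixed by blast
  then have "v = (v + shift i) /\<^sub>R L"
    using sim_shift[of i x] by simp
  from arg_cong[OF this, of "\<lambda>z. L *\<^sub>R z"] have "L *\<^sub>R v = v + shift i"
    using L by simp
  then have "(L - 1) *\<^sub>R v = shift i" by (simp add: algebra_simps)
  then show "(L - 1) *\<^sub>R v \<in> shift ` {1..N}" using x(2) by simp
next
  fix a a' p p'
  assume A: "a \<in> shift ` {1..N}" "a' \<in> shift ` {1..N}" "a \<noteq> a'"
    and K: "p \<in> (\<lambda>x. x - b) ` K" "p' \<in> (\<lambda>x. x - b) ` K" and eq: "p + a = p' + a'"
  obtain i j q q' where ij: "i \<in> {1..N}" "j \<in> {1..N}" "a = shift i" "a' = shift j"
      and q: "q \<in> K" "q' \<in> K" "p = q - b" "p' = q' - b"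
    using A K by blast
  have "sim L \<nu> i q = sim L \<nu> j q'"
    using eq sim_shift[of i q] sim_shift[of j q'] ij q by (metis diff_add_cancel)
  moreover have "i \<noteq> j" using A(3) ij(3,4) by auto
  ultimately have "sim L \<nu> i q \<in> sim L \<nu> i ` V \<inter> sim L \<nu> j ` V" "sim L \<nu> j q' \<in> sim L \<nu> j ` V"
    using nesting[OF ij(1,2)] q by (metis IntD2 IntI imageI)+
  then have "q \<in> V" "q' \<in> V"
    using inj_image_mem_iff[OF inj_sim] by blast+
  then show "p \<in> (\<lambda>x. x - b) ` V \<and> p' \<in> (\<lambda>x. x - b) ` V" using q by simp
next
  fix x y assume "x \<in> (\<lambda>x. x - b) ` V" "y \<in> (\<lambda>x. x - b) ` V"
  then show "norm x = norm y"
    using dist_barycenter by (metis (no_types, lifting) dist_norm imageE)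
next
  fix x y z
  assume "x \<in> (\<lambda>x. x - b) ` V" "y \<in> (\<lambda>x. x - b) ` V" "x \<noteq> y"
  then obtain x' y' where x'y': "x' \<in> V" "y' \<in> V" "x' \<noteq> y'" "x - y = x' - y'" by auto
  obtain i0 where i0: "i0 \<in> {1..N}" using V_fixed[OF x'y'(1)] by blast
  show "refl_along (x - y) z \<in> (\<lambda>x. x - b) ` V" if z: "z \<in> (\<lambda>x. x - b) ` V"
  proof -
    obtain z' where "z' \<in> V" "z = z' - b" using z by blast
    then have "b + refl_along (x - y) z \<in> V"
      using symmetry_barycenter[OF i0 x'y'(1-3)] x'y'(4) by auto
    then show ?thesis by (rule rev_image_eqI) simp
  qed
  show "refl_along (x - y) a \<in> shift ` {1..N}" if a: "a \<in> shift ` {1..N}" for a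
  proof -
    obtain i where i: "i \<in> {1..N}" "a = shift i" using a by blast
    obtain j where j: "j \<in> {1..N}" "bisector_reflection x' y' (sim L \<nu> i b) = sim L \<nu> j b"
      using symmetry_barycenter[OF i(1) x'y'(1-3)] by blast
    have "b + refl_along (x - y) (sim L \<nu> i b - b) = sim L \<nu> j b"
      unfolding x'y'(4) using j(2) bisector_reflection_center[OF x'y'(1-3)] by simp
    then have "refl_along (x - y) (sim L \<nu> i b - b) = sim L \<nu> j b - b"
      by (metis add_diff_cancel_left')
    then have "refl_along (x - y) a = shift j"
      using L by (simp add: sim_shift i linear_scale[OF linear_refl_along])
    then show ?thesis using j(1) by simp
  qed
next
  fix a a' assume "a \<in> shift ` {1..N}" "a' \<in> shift ` {1..N}"
  then show "(a, a') \<in> {(a, a'). a \<in> shift ` {1..N} \<and> a' \<in> shift ` {1..N} \<and>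
    (\<exists>p\<in>(\<lambda>x. x - b) ` K. \<exists>p'\<in>(\<lambda>x. x - b) ` K. p + a = p' + a')}\<^sup>*"
    using cells_linked by blast
qed

end

section \<open>Reflection-closed subsets of the plane are regular polygons\<close>

text \<open>With \<open>u = x - y\<close> the reflection is \<open>- cnj z * (u / cnj u)\<close>,
  and on the circle conjugation sends \<open>w\<close> to \<open>r^2 / w\<close>.\<close>

lemma refl_along_circle:
  fixes x y z :: complex
  assumes "norm x = r" "norm y = r" "norm z = r" "x \<noteq> y"
  shows "refl_along (x - y) z = x * y / z"
proof -
  define u where "u = x - y"
  have r: "r > 0"
  proof (rule ccontr)
    assume "\<not> r > 0"
    then have "norm x \<le> 0" "norm y \<le> 0" using assms by linarith+
    then show False using assms(4) by simp
  qed
  have cnj: "cnj w = (of_real r)\<^sup>2 / w" if "norm w = r" for w :: complex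
  proof -
    have "w * cnj w = (of_real r)\<^sup>2" using that by (simp flip: complex_norm_square)
    moreover have "w \<noteq> 0" using that r by auto
    ultimately show ?thesis by (simp add: field_simps)
  qed
  have nz: "x \<noteq> 0" "y \<noteq> 0" "z \<noteq> 0" "complex_of_real r \<noteq> 0" using assms r by auto
  have u: "u \<noteq> 0" "cnj u \<noteq> 0" using assms(4) by (auto simp: u_def)
  have cu: "cnj u = - (of_real r)\<^sup>2 * u / (x * y)"
    using nz by (simp add: u_def cnj assms field_simps)
  have zu: "2 * complex_of_real (z \<bullet> u) = z * cnj u + cnj z * u"
    by (simp add: complex_eq_iff inner_complex_def algebra_simps)
  have uu: "complex_of_real (u \<bullet> u) = u * cnj u"
    by (simp add: complex_eq_iff inner_complex_def algebra_simps)
  have "refl_along u z = z - (2 * complex_of_real (z \<bullet> u)) / complex_of_real (u \<bullet> u) * u"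
    by (simp add: refl_along_def scaleR_conv_of_real)
  also have "\<dots> = z - (z * cnj u + cnj z * u) / cnj u"
    unfolding zu uu using u by simp
  also have "\<dots> = - cnj z * (u / cnj u)"
    using u by (simp add: field_simps)
  also have "u / cnj u = - x * y / (of_real r)\<^sup>2"
    using u nz by (simp add: cu)
  also have "- cnj z * (- x * y / (of_real r)\<^sup>2) = x * y / z"
    using nz by (simp add: cnj assms)
  finally show ?thesis by (simp add: u_def)
qed

text \<open>On the circle of radius \<open>r\<close> the reflection is \<open>z \<mapsto> x y / z\<close>, so after division by one vertex
  the set becomes a finite multiplicative group.\<close>

lemma refl_closed_complex:
  fixes V :: "complex set"
  assumes V: "finite V" "card V \<ge> 3" and x0: "x0 \<in> V"
    and sphere: "\<And>x y. x \<in> V \<Longrightarrow> y \<in> V \<Longrightarrow> norm x = norm y"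
    and refl: "\<And>x y z. x \<in> V \<Longrightarrow> y \<in> V \<Longrightarrow> x \<noteq> y \<Longrightarrow> z \<in> V \<Longrightarrow> refl_along (x - y) z \<in> V"
  shows "V = range (\<lambda>j::int. x0 * cis (2 * pi * j / card V))"
proof -
  define k where "k = card V"
  define W where "W = {w. x0 * w \<in> V}"
  have "\<not> V \<subseteq> {x0}" using V card_mono[of "{x0}" V] by auto
  then have x00: "x0 \<noteq> 0" using sphere[OF x0] by fastforce
  have V_eq: "V = (*) x0 ` W"
    using x00 by (auto simp: W_def image_iff intro!: exI[of _ "_ / x0"])
  have finW: "finite W" and cardW: "card W = k"
    using V(1) x00 finite_image_iff[of "(*) x0" W] card_image[of "(*) x0" W]
    by (auto simp: V_eq k_def inj_on_def)
  have W1: "1 \<in> W" using x0 by (simp add: W_def)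
  have W: "x * y / z \<in> W" if "x \<in> W" "y \<in> W" "x \<noteq> y" "z \<in> W" for x y z
  proof -
    have "norm (x0 * t) = norm x0" if "t \<in> W" for t
      using sphere[OF x0, of "x0 * t"] that by (simp add: W_def)
    then have "refl_along (x0 * x - x0 * y) (x0 * z) = x0 * x * (x0 * y) / (x0 * z)"
      using that x00 by (intro refl_along_circle) auto
    also have "\<dots> = x0 * (x * y / z)"
      using x00 by simp
    finally show ?thesis
      using refl[of "x0 * x" "x0 * y" "x0 * z"] that x00 by (simp add: W_def)
  qed
  have nzW: "w \<noteq> 0" if "w \<in> W" for w
    using sphere[OF x0, of "x0 * w"] that x00 by (auto simp: W_def)
  have inv: "1 / z \<in> W" if z: "z \<in> W" for z
  proof (cases "z = 1")
    case False
    \<comment> \<open>A third element \<open>x\<close> produces the inverse in two moves: first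
      \<open>x * 1 / z\<close>, then \<open>(x / z) * 1 / x\<close>. The first two arguments of
      \<open>W\<close> must be distinct, which excludes \<open>x = 1\<close> and
      \<open>x = z\<close>.\<close>
    have "\<not> W \<subseteq> {1, z}"
      using card_mono[of "{1, z}" W] V(2) cardW card_insert_le_m1[of 2 "{z}" 1] k_def by auto
    then obtain x where x: "x \<in> W" "x \<noteq> 1" "x \<noteq> z" by blast
    then have "x / z \<in> W" using W[of x 1 z] W1 z by simp
    then have "x / z * 1 / x \<in> W" using W[of "x / z" 1 x] W1 x nzW[OF z] by simp
    then show ?thesis using nzW[OF x(1)] by simp
  qed (use W1 in simp)
  have mult: "x * y \<in> W" if "x \<in> W" "y \<in> W" for x y
    using W[of x 1 "1 / y"] inv[OF that(2)] W1 that by (cases "x = 1") auto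
  \<comment> \<open>Multiplication by \<open>w\<close> permutes \<open>W\<close>, so the nonzero
    product of all elements of \<open>W\<close> is unchanged by the factor
    \<open>w ^ k\<close>.\<close>
  have root: "w ^ k = 1" if w: "w \<in> W" for w
  proof -
    have inj: "inj_on ((*) w) W" using nzW[OF w] by (auto simp: inj_on_def)
    have "(*) w ` W = W"
      using mult[OF w] inj finW by (intro card_subset_eq) (auto simp: card_image)
    then have "prod id W = (\<Prod>x\<in>W. w * x)"
      using prod.reindex[OF inj, of id] by simp
    also have "\<dots> = w ^ k * prod id W"
      by (simp add: prod.distrib cardW)
    finally show ?thesis using nzW finW by (auto simp: prod_zero_iff)
  qed
  have k: "k > 0" using V k_def by simp
  have W_roots: "W = {w. w ^ k = 1}"
    using root k by (intro card_subset_eq) (auto simp: finite_roots_unity cardW card_roots_unity_eq)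
  have "W = range (\<lambda>j::int. cis (2 * pi * j / k))"
  proof (intro equalityI subsetI)
    fix w assume "w \<in> W"
    then have "w \<in> (\<lambda>j. cis (2 * pi * real j / real k)) ` {..<k}"
      using Complex.bij_betw_roots_unity[OF k] by (simp add: W_roots bij_betw_def)
    then obtain j where "w = cis (2 * pi * real j / real k)" by blast
    then show "w \<in> range (\<lambda>j::int. cis (2 * pi * j / k))"
      by (intro range_eqI[of _ _ "int j"]) simp
  next
    fix w assume "w \<in> range (\<lambda>j::int. cis (2 * pi * j / k))"
    then obtain j :: int where "w = cis (2 * pi * j / k)" by blast
    then have "w ^ k = cis (real k * (2 * pi * j / k))" by (simp add: Complex.DeMoivre)
    also have "\<dots> = cis (2 * pi * j)" using k by simp
    finally show "w \<in> W" by (simp add: W_roots cis_multiple_2pi)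
  qed
  from V_eq[unfolded this] have "V = (*) x0 ` range (\<lambda>j::int. cis (2 * pi * j / k))" .
  then show ?thesis unfolding image_image k_def .
qed

text \<open>Identifying the plane with the complex numbers preserves inner products and hence
  \<open>refl_along\<close>. The vector with entries \<open>- x0 $ 2\<close> and
  \<open>x0 $ 1\<close> is \<open>x0\<close> turned by a right angle, that is, multiplied by the
  imaginary unit.\<close>

lemma refl_closed_plane:
  fixes V :: "(real^2) set"
  assumes V: "finite V" "card V \<ge> 3" and x0: "x0 \<in> V"
    and sphere: "\<And>x y. x \<in> V \<Longrightarrow> y \<in> V \<Longrightarrow> norm x = norm y"
    and refl: "\<And>x y z. x \<in> V \<Longrightarrow> y \<in> V \<Longrightarrow> x \<noteq> y \<Longrightarrow> z \<in> V \<Longrightarrow> refl_along (x - y) z \<in> V"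
  shows "V = range (\<lambda>j::int. cos (2 * pi * j / card V) *\<^sub>R x0 +
    sin (2 * pi * j / card V) *\<^sub>R vector [- x0 $ 2, x0 $ 1])"
proof -
  define \<phi> :: "real^2 \<Rightarrow> complex" where "\<phi> v = Complex (v $ 1) (v $ 2)" for v
  have inj: "inj \<phi>" by (auto simp: inj_def \<phi>_def vec_eq_iff forall_2)
  have inner: "\<phi> x \<bullet> \<phi> y = x \<bullet> y" for x y
    by (simp add: \<phi>_def inner_complex_def inner_vec_def sum_2)
  have nrm: "norm (\<phi> x) = norm x" for x
    by (simp add: norm_eq_sqrt_inner inner)
  have diff: "\<phi> (x - y) = \<phi> x - \<phi> y" for x y by (simp add: \<phi>_def complex_eq_iff)
  have "refl_along (\<phi> u) (\<phi> z) = \<phi> (refl_along u z)" for u z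
    unfolding refl_along_def inner diff by (simp add: \<phi>_def complex_eq_iff)
  then have refl': "refl_along (\<phi> x - \<phi> y) (\<phi> z) = \<phi> (refl_along (x - y) z)" for x y z
    by (simp flip: diff)
  have card: "card (\<phi> ` V) = card V"
    using inj by (intro card_image inj_on_subset[OF inj]) simp
  have "\<phi> ` V = range (\<lambda>j::int. \<phi> x0 * cis (2 * pi * j / card (\<phi> ` V)))"
  proof (rule refl_closed_complex)
    show "finite (\<phi> ` V)" "3 \<le> card (\<phi> ` V)" "\<phi> x0 \<in> \<phi> ` V"
      using V x0 card by auto
    show "norm x = norm y" if "x \<in> \<phi> ` V" "y \<in> \<phi> ` V" for x y
      using that sphere nrm by (metis imageE)
    show "refl_along (x - y) z \<in> \<phi> ` V"
      if "x \<in> \<phi> ` V" "y \<in> \<phi> ` V" "x \<noteq> y" "z \<in> \<phi> ` V" for x y z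
      using that by (auto simp: refl' intro!: imageI refl)
  qed
  also have "(\<lambda>j::int. \<phi> x0 * cis (2 * pi * j / card (\<phi> ` V))) =
    \<phi> \<circ> (\<lambda>j::int. cos (2 * pi * j / card V) *\<^sub>R x0 +
      sin (2 * pi * j / card V) *\<^sub>R vector [- x0 $ 2, x0 $ 1])"
    unfolding card by (simp add: fun_eq_iff \<phi>_def complex_eq_iff vector_2)
  finally show ?thesis
    using inj by (simp only: image_comp[symmetric] inj_image_eq_iff)
qed

section \<open>Vertices and mirrors of a regular polygon\<close>

locale regular_polygon =
  fixes V :: "(real^2) set" and k :: nat and r :: real
  assumes k: "k \<ge> 3" and r: "r > 0"
    and vertices: "\<And>x0. x0 \<in> V \<Longrightarrow> norm x0 = r \<and>
      V = range (\<lambda>j::int. cos (2 * pi * j / k) *\<^sub>R x0 +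
        sin (2 * pi * j / k) *\<^sub>R vector [- x0 $ 2, x0 $ 1])"
begin

text \<open>Any vertex can be given index 0, and integer indices spare all reduction modulo
  \<open>k\<close>. The two strip lemmas below compute with these inner products only.\<close>

lemma enumeration:
  assumes "x0 \<in> V"
  obtains e :: "int \<Rightarrow> real^2" where "e 0 = x0" "V = range e"
    "\<And>i j. e i \<bullet> e j = r\<^sup>2 * cos (2 * pi * (real_of_int i - real_of_int j) / k)"
proof -
  define e :: "int \<Rightarrow> real^2" where "e j = cos (2 * pi * j / k) *\<^sub>R x0 +
        sin (2 * pi * j / k) *\<^sub>R vector [- x0 $ 2, x0 $ 1]" for j
  have r2: "(x0 $ 1)\<^sup>2 + (x0 $ 2)\<^sup>2 = r\<^sup>2"
    using vertices[OF assms]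
    by (auto simp: norm_eq_sqrt_inner inner_vec_def sum_2 power2_eq_square)
  have "e i \<bullet> e j = r\<^sup>2 * cos (2 * pi * (real_of_int i - real_of_int j) / k)" for i j
  proof -
    have "cos (2 * pi * (real_of_int i - real_of_int j) / k) = cos (2 * pi * i / k - 2 * pi * j / k)"
      by (simp add: diff_divide_distrib right_diff_distrib)
    then show ?thesis
      unfolding r2[symmetric]
      by (simp add: e_def inner_vec_def sum_2 vector_2 cos_diff power2_eq_square algebra_simps)
  qed
  moreover have "e 0 = x0" "V = range e"
    using vertices[OF assms] by (auto simp: e_def)
  ultimately show thesis using that by blast
qed

lemma differences_span:
  assumes "V \<noteq> {}" "a \<noteq> 0"
  shows "\<exists>x\<in>V. \<exists>y\<in>V. a \<bullet> (x - y) \<noteq> 0"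
proof (rule ccontr)
  assume not: "\<not> ?thesis"
  obtain x0 where x0: "x0 \<in> V" using assms(1) by blast
  let ?f = "vector [- x0 $ 2, x0 $ 1] :: real^2"
  let ?e = "\<lambda>j::int. cos (2 * pi * j / k) *\<^sub>R x0 + sin (2 * pi * j / k) *\<^sub>R ?f"
  have V: "V = range ?e" "norm x0 = r" using vertices[OF x0] by blast+
  have zero: "a \<bullet> (?e i - ?e j) = 0" for i j
    using not V(1) by blast
  have s: "sin (2 * pi / k) > 0"
    using k by (intro sin_gt_zero) (auto simp: field_simps)
  then have c: "cos (2 * pi / k) \<noteq> 1" using cos_one_sin_zero by fastforce
  \<comment> \<open>The difference of the vertices with indices 1 and -1 is a multiple of
    \<open>?f\<close>; the one of indices 1 and 0 then gives orthogonality to \<open>x0\<close> as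
    well.\<close>
  have f: "a \<bullet> ?f = 0"
    using zero[of 1 "-1"] s by (simp add: inner_diff_right inner_add_right flip: scaleR_2)
  have x: "a \<bullet> x0 = 0"
    using zero[of 1 0] f c by (simp add: inner_diff_right inner_add_right)
  have r2: "x0 $ 1 * x0 $ 1 + x0 $ 2 * x0 $ 2 = r * r"
    using V(2) by (auto simp: norm_eq_sqrt_inner inner_vec_def sum_2)
  have "a $ 1 * x0 $ 1 + a $ 2 * x0 $ 2 = 0" "a $ 2 * x0 $ 1 - a $ 1 * x0 $ 2 = 0"
    using f x by (simp_all add: inner_vec_def sum_2 vector_2 algebra_simps)
  then have "a $ 1 * (r * r) = 0" "a $ 2 * (r * r) = 0"
    unfolding r2[symmetric] by algebra+
  then have "a = 0" using r by (simp add: vec_eq_iff forall_2)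
  then show False using assms(2) by simp
qed

text \<open>For the bisector of \<open>v\<close> and an adjacent vertex, the next vertex is farther
  from the mirror than \<open>v\<close> by the factor \<open>1 + 2 * cos (2 * pi / k)\<close>, which
  exceeds 1 because \<open>k > 4\<close>.\<close>

lemma vertex_inside_strip:
  assumes "k > 4" "v \<in> V"
  shows "\<exists>x\<in>V. \<exists>y\<in>V. \<exists>s\<in>V. v \<bullet> (x - y) \<noteq> 0 \<and> \<bar>v \<bullet> (x - y)\<bar> < \<bar>s \<bullet> (x - y)\<bar>"
proof -
  obtain e :: "int \<Rightarrow> real^2" where e: "e 0 = v" "V = range e"
    "\<And>i j. e i \<bullet> e j = r\<^sup>2 * cos (2 * pi * (real_of_int i - real_of_int j) / k)"
    using enumeration[OF assms(2)] by metis
  define c where "c = cos (2 * pi / k)"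
  have c: "0 < c" "c < 1"
  proof -
    have angle: "0 < 2 * pi / k" "2 * pi / k < pi / 2"
      using assms(1) by (simp_all add: field_simps)
    then show "0 < c" unfolding c_def by (intro cos_gt_zero) auto
    show "c < 1"
      unfolding c_def using angle cos_monotone_0_pi[of 0 "2 * pi / k"] by simp
  qed
  have e2: "e 2 \<bullet> e 0 = r\<^sup>2 * (2 * c\<^sup>2 - 1)" "e 2 \<bullet> e 1 = r\<^sup>2 * c"
    using cos_double_cos[of "2 * pi / k"] by (simp_all add: c_def e(3) mult_ac)
  have v: "e 0 \<bullet> (e 0 - e 1) = r\<^sup>2 * (1 - c)"
    by (simp add: inner_diff_right e(3) c_def algebra_simps)
  have s: "e 2 \<bullet> (e 0 - e 1) = - (r\<^sup>2 * (1 - c)) * (1 + 2 * c)"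
    by (simp add: inner_diff_right e2 power2_eq_square algebra_simps)
  have "r\<^sup>2 * (1 - c) > 0" using c r by simp
  moreover from this have "r\<^sup>2 * (1 - c) * 1 < r\<^sup>2 * (1 - c) * (1 + 2 * c)"
    using c by (intro mult_strict_left_mono) auto
  ultimately have "e 0 \<bullet> (e 0 - e 1) \<noteq> 0" "\<bar>e 0 \<bullet> (e 0 - e 1)\<bar> < \<bar>e 2 \<bullet> (e 0 - e 1)\<bar>"
    unfolding v s using c by (auto simp: abs_mult)
  then show ?thesis unfolding e(2) e(1)[symmetric] by blast
qed

lemma chord_inside_strip:
  assumes k: "k > 4" "k \<noteq> 6" and vw: "v \<in> V" "w \<in> V" "v \<noteq> w"
  shows "\<exists>x\<in>V. \<exists>y\<in>V. \<exists>s\<in>V. (v - w) \<bullet> (x - y) \<noteq> 0 \<and>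
    \<bar>(v - w) \<bullet> (x - y)\<bar> < \<bar>s \<bullet> (x - y)\<bar>"
proof -
  obtain e :: "int \<Rightarrow> real^2" where e: "e 0 = w" "V = range e"
    "\<And>i j. e i \<bullet> e j = r\<^sup>2 * cos (2 * pi * (real_of_int i - real_of_int j) / k)"
    using enumeration[OF vw(2)] by metis
  obtain m where m: "v = e m" using e(2) vw(1) by blast
  txt \<open>The chord has direction \<open>pi / 2 + pi * m / k\<close> and the mirrors have directions
    \<open>pi * c / k\<close>; \<open>c = m - n\<close> is the mirror closest to the chord but not parallel to it.  The
    requirement \<open>3 * k \<le> 8 * n\<close>, giving \<open>tan (pi * n / k) > 2\<close>, is what fails for \<open>k = 6\<close>.\<close>
  define n where "n = (int k - 1) div 2"
  have n: "3 * int k \<le> 8 * n" "2 * n < int k" "2 * n + 2 \<ge> int k"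
    unfolding n_def using k by presburger+
  define c where "c = m - n"
  \<comment> \<open>The bisector of \<open>e p\<close> and \<open>e q\<close> has direction
    \<open>pi * (p + q) / k\<close>. The parity of \<open>c\<close> decides whether neighbors or
    vertices two apart have index sum \<open>c\<close>.\<close>
  obtain p q where pq: "p + q = c" "p - q = 1 \<or> p - q = 2"
  proof (cases "even c")
    case True
    then show thesis using that[of "c div 2 + 1" "c div 2 - 1"] by auto
  next
    case False
    then have "(c div 2 + 1) + c div 2 = c" by presburger
    then show thesis using that[of "c div 2 + 1" "c div 2"] by simp
  qed
  \<comment> \<open>The vertex \<open>e j\<close> makes the angle
    \<open>pi * (2 * j - c) / k\<close> with the mirror, as close to a right angle as the parity of
    \<open>c\<close> permits.\<close>
  define j where "j = (c + n + 1) div 2"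
  have j: "2 * j - c = n \<or> 2 * j - c = n + 1" unfolding j_def by presburger
  have cos_diff_add: "cos (a - b) - cos (a + b) = 2 * sin a * sin b" for a b :: real
    by (simp add: cos_diff cos_add)
  \<comment> \<open>This product and the one in \<open>vertex\<close> share the factor
    \<open>2 * r\<^sup>2 * sin (pi * (p - q) / k)\<close>, so it remains to compare
    \<open>2 * sin (pi * m / k) * cos (pi * n / k)\<close> with
    \<open>sin (pi * (2 * j - c) / k)\<close>.\<close>
  have chord: "(e m - e 0) \<bullet> (e p - e q) =
      4 * r\<^sup>2 * sin (pi * m / k) * sin (pi * real_of_int (p - q) / k) * cos (pi * real_of_int n / k)"
  proof -
    define M P Q where "M = pi * m / k" "P = pi * p / k" "Q = pi * q / k"
    have "(e m - e 0) \<bullet> (e p - e q) =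
        r\<^sup>2 * (cos (2*M - 2*P) - cos (2*M - 2*Q) - cos (- 2*P) + cos (- 2*Q))"
      by (simp add: inner_diff_left inner_diff_right e(3) M_P_Q_def algebra_simps
          diff_divide_distrib)
    also have "cos (2*M - 2*P) - cos (2*M - 2*Q) = 2 * sin (2*M - (P+Q)) * sin (P - Q)"
      using cos_diff_add[of "2*M - (P+Q)" "P - Q"] by (simp add: algebra_simps)
    also have "r\<^sup>2 * (2 * sin (2*M - (P+Q)) * sin (P - Q) - cos (- 2*P) + cos (- 2*Q)) =
        r\<^sup>2 * (2 * sin (P - Q) * (sin (2*M - (P+Q)) + sin (P + Q)))"
      using cos_diff_add[of "P + Q" "P - Q"] by (simp add: algebra_simps)
    also have "sin (2*M - (P+Q)) + sin (P + Q) = 2 * sin M * cos (M - (P + Q))"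
      using sin_add[of M "M - (P + Q)"] sin_diff[of M "M - (P + Q)"] by (simp add: algebra_simps)
    also have "M - (P + Q) = pi * real_of_int n / k"
    proof -
      have n_eq: "n = m - (p + q)" using pq(1) by (simp add: c_def)
      show ?thesis
        unfolding M_P_Q_def n_eq by (simp add: algebra_simps add_divide_distrib diff_divide_distrib)
    qed
    also have "P - Q = pi * real_of_int (p - q) / k"
      by (simp add: M_P_Q_def algebra_simps diff_divide_distrib)
    finally show ?thesis by (simp add: M_P_Q_def)
  qed
  have vertex: "e j \<bullet> (e p - e q) =
      2 * r\<^sup>2 * sin (pi * real_of_int (2 * j - c) / k) * sin (pi * real_of_int (p - q) / k)"
  proof -
    define J P Q where "J = pi * j / k" "P = pi * p / k" "Q = pi * q / k"
    have "e j \<bullet> (e p - e q) = r\<^sup>2 * (cos (2*J - 2*P) - cos (2*J - 2*Q))"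
      by (simp add: inner_diff_right e(3) J_P_Q_def algebra_simps diff_divide_distrib)
    also have "cos (2*J - 2*P) - cos (2*J - 2*Q) = 2 * sin (2*J - (P+Q)) * sin (P - Q)"
      using cos_diff_add[of "2*J - (P+Q)" "P - Q"] by (simp add: algebra_simps)
    also have "2*J - (P+Q) = pi * real_of_int (2 * j - c) / k"
      by (simp add: J_P_Q_def pq(1)[symmetric] algebra_simps diff_divide_distrib add_divide_distrib)
    also have "P - Q = pi * real_of_int (p - q) / k"
      by (simp add: J_P_Q_def algebra_simps diff_divide_distrib)
    finally show ?thesis by simp
  qed
  define S C D where "S = sin (pi * n / k)" "C = cos (pi * n / k)" "D = sin (pi * (p - q) / k)"
  have angle: "3 * pi / 8 \<le> pi * n / k" "pi * n / k < pi / 2"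
  proof -
    have "3 * real k \<le> 8 * n" "2 * n < real k"
      using n by linarith+
    then show "3 * pi / 8 \<le> pi * n / k" "pi * n / k < pi / 2"
      using k by (simp_all add: field_simps)
  qed
  have angle0: "0 < pi * n / k"
    using angle(1) pi_gt_zero by linarith
  have C: "0 < C"
    unfolding S_C_D_def using angle angle0 by (intro cos_gt_zero) auto
  have S: "0 < S"
    unfolding S_C_D_def using angle(2) angle0 by (intro sin_gt_zero) linarith+
  \<comment> \<open>The goal \<open>2 * C < S\<close> amounts to
    \<open>2 * C\<^sup>2 - 1 < - 3 / 5\<close>; the double angle is at least
    \<open>3 * pi / 4\<close>, and \<open>- 7 / 10\<close> is a convenient rational bound.\<close>
  have "2 * C\<^sup>2 - 1 = cos (2 * (pi * n / k))"
    unfolding S_C_D_def cos_double_cos ..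
  also have "\<dots> \<le> cos (3 * pi / 4)"
    using angle by (intro cos_monotone_0_pi_le) linarith+
  also have "\<dots> = - (sqrt 2 / 2)"
    using cos_pi_minus[of "pi / 4"] cos_45 by (simp add: field_simps)
  also have "\<dots> < - (7 / 10)"
    using real_less_rsqrt[of "7/5" 2] by (simp add: power2_eq_square)
  finally have "2 * C\<^sup>2 - 1 < - (7 / 10)" .
  moreover have "S\<^sup>2 + C\<^sup>2 = 1" by (simp add: S_C_D_def)
  ultimately have "(2 * C)\<^sup>2 < S\<^sup>2" unfolding power_mult_distrib by simp
  then have CS: "2 * C < S"
    by (rule power2_less_imp_less) (use S in simp)
  have D: "0 < D"
    unfolding S_C_D_def using pq(2) k by (intro sin_gt_zero) (auto simp: field_simps)
  have Sj: "S \<le> sin (pi * (2 * j - c) / k)"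
  proof (cases "2 * j - c = n")
    case False
    then have j': "2 * j - c = n + 1" using j by simp
    \<comment> \<open>The sine at \<open>n + 1\<close> equals the one at \<open>k - n - 1\<close>,
      an index between \<open>n\<close> and \<open>k / 2\<close>, where the sine is
      increasing.\<close>
    have "real_of_int n \<le> real k - n - 1" "real k \<le> 2 * n + 2"
      using n by linarith+
    then have "pi * n / k \<le> pi * (real k - n - 1) / k"
      by (intro divide_right_mono mult_left_mono) auto
    moreover have "(real k - n - 1) / k \<le> 1 / 2"
      using \<open>real k \<le> 2 * n + 2\<close> k by (subst pos_divide_le_eq) auto
    then have "pi * (real k - n - 1) / k \<le> pi / 2"
      using mult_left_mono[of "(real k - n - 1) / k" "1 / 2" pi] by simp
    ultimately have "S \<le> sin (pi * (real k - n - 1) / k)"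
      unfolding S_C_D_def using angle0 by (intro sin_monotone_2pi_le) linarith+
    also have "pi * (real k - n - 1) / k = pi - pi * (n + 1) / k"
      using k by (simp add: field_simps)
    finally show ?thesis by (simp add: j')
  qed (simp add: S_C_D_def)
  have "sin (pi * m / k) \<noteq> 0"
  proof
    assume "sin (pi * m / k) = 0"
    then have "cos (2 * pi * m / k) = 1"
      using cos_double_sin[of "pi * m / k"] by (simp add: mult.assoc)
    then have "(v - w) \<bullet> (v - w) = 0"
      by (simp add: m e(1)[symmetric] inner_diff_left inner_diff_right e(3))
    then show False using vw(3) by simp
  qed
  then have ne: "(v - w) \<bullet> (e p - e q) \<noteq> 0"
    unfolding m e(1)[symmetric] chord using C D r by (simp add: S_C_D_def)
  have "\<bar>(v - w) \<bullet> (e p - e q)\<bar> = 4 * r\<^sup>2 * \<bar>sin (pi * m / k)\<bar> * D * C"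
    unfolding m e(1)[symmetric] chord using C D
    by (simp add: S_C_D_def abs_mult)
  also have "\<dots> \<le> 4 * r\<^sup>2 * 1 * D * C"
    using C D by (intro mult_right_mono mult_left_mono) auto
  also have "\<dots> = 2 * r\<^sup>2 * D * (2 * C)" by simp
  also have "\<dots> < 2 * r\<^sup>2 * D * S"
    using CS D r by (intro mult_strict_left_mono) auto
  also have "\<dots> \<le> 2 * r\<^sup>2 * D * sin (pi * (2 * j - c) / k)"
    using Sj D by (intro mult_left_mono) auto
  also have "\<dots> \<le> \<bar>e j \<bullet> (e p - e q)\<bar>"
    unfolding vertex S_C_D_def by (simp add: mult_ac)
  finally show ?thesis using ne unfolding e(2) by blast
qed

end

section \<open>Contradiction from a cell near the barycenter\<close>

theorem lemma3p3:
  fixes L :: real and N k :: nat and \<nu> :: "nat \<Rightarrow> real^2" and K\<^sub>0 K\<^sub>1 :: "(real^2) set"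
  assumes "simple_nested_fractal L N \<nu> K\<^sub>0"
    and "k = card (essential_fixed_points L N \<nu>)"
    and "k > 4" and "k \<noteq> 6"
    and "K\<^sub>1 = (\<lambda>x. L *\<^sub>R x) ` K\<^sub>0"
  shows "barycenter ((\<lambda>x. L *\<^sub>R x) ` essential_fixed_points L N \<nu>) \<notin> K\<^sub>1"
proof
  assume bary: "barycenter ((\<lambda>x. L *\<^sub>R x) ` essential_fixed_points L N \<nu>) \<in> K\<^sub>1"
  define V where "V = essential_fixed_points L N \<nu>"
  define b where "b = barycenter V"
  interpret S: snf L N \<nu> K\<^sub>0 V b
    using assms(1) by unfold_locales (simp_all add: V_def b_def)
  let ?V = "(\<lambda>x. x - b) ` V"
  interpret C: centered_snf L "S.shift ` {1..N}" ?V "(\<lambda>x. x - b) ` K\<^sub>0"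
    by (rule S.centered)
  have card: "card ?V = k"
    using assms(2) by (simp add: V_def card_image inj_on_def)
  have ne: "?V \<noteq> {}" using S.V_ne by simp
  then obtain x0 where x0: "x0 \<in> ?V" by blast
  interpret P: regular_polygon ?V k "norm x0"
  proof
    show "k \<ge> 3" using assms(3) by simp
    show "norm x0 > 0"
    proof (rule ccontr)
      assume "\<not> norm x0 > 0"
      then have "norm x = 0" if "x \<in> ?V" for x using C.sphere[OF that x0] by simp
      then have "?V \<subseteq> {0}" by (metis norm_eq_zero singletonI subsetI)
      then have "card ?V \<le> 1" using card_mono[of "{0}" ?V] by simp
      then show False using card assms(3) by simp
    qed
    fix x assume x: "x \<in> ?V"
    show "norm x = norm x0 \<and> ?V = range (\<lambda>j::int. cos (2 * pi * j / k) *\<^sub>R x +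
        sin (2 * pi * j / k) *\<^sub>R vector [- x $ 2, x $ 1])"
      using refl_closed_plane[OF C.finite_V _ x C.sphere C.refl_V] C.sphere[OF x x0]
        card assms(3) by simp
  qed
  \<comment> \<open>Scaling by \<open>L\<close> commutes with taking barycenters, so the question is
    whether \<open>b\<close> lies in the unscaled fractal.\<close>
  have "barycenter ((\<lambda>x. L *\<^sub>R x) ` V) = L *\<^sub>R b"
    using barycenter_affine_image[of "\<lambda>x. L *\<^sub>R x" V 0] S.finite_V S.V_ne S.L
    by (simp add: b_def linear_scaleR inj_def)
  then have "b \<in> K\<^sub>0" using bary S.L by (auto simp: assms(5) V_def)
  then have zero: "0 \<in> (\<lambda>x. x - b) ` K\<^sub>0" by (simp add: image_iff)
  have "x0 \<noteq> 0" using P.r by auto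
  then obtain a where a: "a \<in> S.shift ` {1..N}" "a \<noteq> 0"
      "- a \<in> ?V \<or> (\<exists>v\<in>?V. \<exists>w\<in>?V. a = v - w)"
    using C.cell_translations_of_center[OF zero P.differences_span[OF ne] x0] by blast
  have "\<exists>x\<in>?V. \<exists>y\<in>?V. \<exists>s\<in>?V. a \<bullet> (x - y) \<noteq> 0 \<and> \<bar>a \<bullet> (x - y)\<bar> < \<bar>s \<bullet> (x - y)\<bar>"
    using a(3)
  proof
    assume "- a \<in> ?V"
    from P.vertex_inside_strip[OF assms(3) this] show ?thesis by simp
  next
    assume "\<exists>v\<in>?V. \<exists>w\<in>?V. a = v - w"
    then obtain v w where "v \<in> ?V" "w \<in> ?V" "a = v - w" by blast
    then show ?thesis
      using P.chord_inside_strip[OF assms(3,4), of v w] a(2) by auto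
  qed
  then show False using C.mirror_misses_cell[OF a(1)] by (meson not_less)
qed

end
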